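(* Let $A\in\mathbb{C}^{n\times n}$ be full rank with all eigenvalues of modulus strictly less than $1$, with distinct eigenvalues $\lambda_1,\dots,\lambda_K$, each of geometric multiplicity $1$. Let $x_0=0$ and $x_{t+1}=Ax_t+w_t$ with $w_t\sim\mathcal N(0,I_n)$ i.i.d. For $m\in\{1,\dots,K\}$ put $w_t^m:=P_{\lambda_m}w_t$ and $$B_{\lambda_m}(i):=\sum_{t=1}^i A_{\lambda_m}^{i-t}w_{t-1}^m .$$ Then for every $i\ge1$, $x_i=\sum_{m=1}^K B_{\lambda_m}(i)$; each $w_{t}^m$ is a standard normal on the $A$-invariant subspace $M_{\lambda_m}$, which has dimension $D_{\lambda_m}+1$; and for $m\ne m'$ the random vectors $B_{\lambda_m}(i)$ and $B_{\lambda_{m'}}(i)$ are statistically independent for all $i$. Consequently the data matrix $[x_0,x_1,\dots,x_{N-1}]$ is composed of time realizations of $K$ lower-dimensional dynamical systems which are statistically independent of each other.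
   Context: For an eigenvalue $\lambda_m$ with algebraic multiplicity $m_m$, $M_{\lambda_m}=N\big((A-\lambda_m I)^{m_m}\big)$ is the generalized eigenspace, and $D_{\lambda_m}$ is the algebraic multiplicity minus the geometric multiplicity of $\lambda_m$. $P_{\lambda_m}$ denotes the orthogonal projection onto $M_{\lambda_m}$; the setting takes $\mathbb{C}^n=M_{\lambda_1}\oplus\cdots\oplus M_{\lambda_K}$ and correspondingly $I_n=P_{\lambda_1}\oplus\cdots\oplus P_{\lambda_K}$, with the $P_{\lambda_m}$ orthogonal projections. $A_{\lambda_m}$ is the restriction of $A$ to $M_{\lambda_m}$ via $P_{\lambda_m}$. *)

theory Defs
  imports "HOL-Probability.Probability" "HOL-Computational_Algebra.Polynomial"
begin

definition charpoly :: "complex^'n^'n \<Rightarrow> complex poly" where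
  "charpoly A = det (mat [:0, 1:] - map_matrix (\<lambda>a. [:a:]) A)"

definition eigenvalue :: "complex^'n^'n \<Rightarrow> complex \<Rightarrow> bool" where
  "eigenvalue A c \<longleftrightarrow> (\<exists>v. v \<noteq> 0 \<and> A *v v = c *s v)"

definition alg_mult :: "complex^'n^'n \<Rightarrow> complex \<Rightarrow> nat" where
  "alg_mult A c = order c (charpoly A)"

definition geo_mult :: "complex^'n^'n \<Rightarrow> complex \<Rightarrow> nat" where
  "geo_mult A c = vec.dim {v. (A - mat c) *v v = 0}"

text \<open>The difference is taken in the integers, so it is never truncated.\<close>

definition defect :: "complex^'n^'n \<Rightarrow> complex \<Rightarrow> int" where
  "defect A c = int (alg_mult A c) - int (geo_mult A c)"

text \<open>The null space of the matrix power is written with iterated application, because \<open>^\<close> on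
  \<open>complex^'n^'n\<close> is the entrywise power.\<close>

definition gen_eigenspace :: "complex^'n^'n \<Rightarrow> complex \<Rightarrow> (complex^'n) set" where
  "gen_eigenspace A c = {v. ((\<lambda>u. (A - mat c) *v u) ^^ alg_mult A c) v = 0}"

text \<open>The Hermitian inner product; \<open>inner\<close> on \<open>complex^'n\<close> is only its real part. Its associated
  norm is the library \<open>norm\<close>.\<close>

definition cinner :: "complex^'n \<Rightarrow> complex^'n \<Rightarrow> complex" where
  "cinner x y = (\<Sum>i\<in>UNIV. x $ i * cnj (y $ i))"

definition orth_proj :: "(complex^'n) set \<Rightarrow> complex^'n \<Rightarrow> complex^'n" where
  "orth_proj V x = (THE y. y \<in> V \<and> (\<forall>z\<in>V. cinner (x - y) z = 0))"

abbreviation spectral_proj :: "complex^'n^'n \<Rightarrow> complex \<Rightarrow> complex^'n \<Rightarrow> complex^'n" where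
  "spectral_proj A c \<equiv> orth_proj (gen_eigenspace A c)"

definition restr :: "complex^'n^'n \<Rightarrow> complex \<Rightarrow> complex^'n \<Rightarrow> complex^'n" where
  "restr A c v = A *v spectral_proj A c v"

text \<open>The density, with respect to Lebesgue measure, of the circularly symmetric complex normal law
  with mean \<open>0\<close> and covariance \<open>E(w w\<^sup>*) = I\<close> in complex dimension \<open>d\<close>: real and imaginary parts of
  the coordinates are independent with variance 1/2. Real noise would not do: its projections onto
  the eigenspaces of a conjugate pair of eigenvalues of a real normal matrix are complex conjugates
  of each other, hence dependent.\<close>

definition std_complex_normal_density :: "nat \<Rightarrow> 'a::real_normed_vector \<Rightarrow> real" where
  "std_complex_normal_density d z = exp (- (norm z)\<^sup>2) / pi ^ d"

definition std_complex_normal :: "'a measure \<Rightarrow> ('a \<Rightarrow> complex^'n) \<Rightarrow> bool" where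
  "std_complex_normal M X \<longleftrightarrow>
     distributed M lborel X (\<lambda>z. ennreal (std_complex_normal_density CARD('n) z))"

definition orthonormal_basis :: "(complex^'n) set \<Rightarrow> (nat \<Rightarrow> complex^'n) \<Rightarrow> bool" where
  "orthonormal_basis V b \<longleftrightarrow>
     (\<forall>j<vec.dim V. b j \<in> V) \<and>
     (\<forall>j<vec.dim V. \<forall>k<vec.dim V. cinner (b j) (b k) = (if j = k then 1 else 0))"

text \<open>A proper subspace is Lebesgue null, so the law is described through coordinates: with respect
  to every orthonormal basis of \<open>V\<close> they are i.i.d. standard complex normal.\<close>

definition std_complex_normal_on ::
    "'a measure \<Rightarrow> (complex^'n) set \<Rightarrow> ('a \<Rightarrow> complex^'n) \<Rightarrow> bool" where
  "std_complex_normal_on M V X \<longleftrightarrow>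
     vec.subspace V \<and> X \<in> borel_measurable M \<and> (\<forall>\<omega>\<in>space M. X \<omega> \<in> V) \<and>
     (\<forall>b. orthonormal_basis V b \<longrightarrow>
        prob_space.indep_vars M (\<lambda>_. borel) (\<lambda>k \<omega>. cinner (X \<omega>) (b k)) {..<vec.dim V} \<and>
        (\<forall>k<vec.dim V. distributed M lborel (\<lambda>\<omega>. cinner (X \<omega>) (b k))
           (\<lambda>z. ennreal (std_complex_normal_density 1 z))))"

definition linear_system ::
    "(complex^'n \<Rightarrow> complex^'n) \<Rightarrow> (nat \<Rightarrow> complex^'n) \<Rightarrow> (nat \<Rightarrow> complex^'n) \<Rightarrow> bool" where
  "linear_system F u x \<longleftrightarrow> x 0 = 0 \<and> (\<forall>t. x (Suc t) = F (x t) + u t)"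

definition proj_noise ::
    "complex^'n^'n \<Rightarrow> (nat \<Rightarrow> 'a \<Rightarrow> complex^'n) \<Rightarrow> complex \<Rightarrow> nat \<Rightarrow> 'a \<Rightarrow> complex^'n" where
  "proj_noise A w c t \<omega> = spectral_proj A c (w t \<omega>)"

definition B_proc ::
    "complex^'n^'n \<Rightarrow> (nat \<Rightarrow> 'a \<Rightarrow> complex^'n) \<Rightarrow> complex \<Rightarrow> nat \<Rightarrow> 'a \<Rightarrow> complex^'n" where
  "B_proc A w c i \<omega> = (\<Sum>t=1..i. (restr A c ^^ (i - t)) (proj_noise A w c (t - 1) \<omega>))"

text \<open>The matrix with columns \<open>x 0, \<dots>, x (N - 1)\<close>, as a column-indexed family.\<close>

definition data_matrix :: "nat \<Rightarrow> (nat \<Rightarrow> 'a \<Rightarrow> complex^'n) \<Rightarrow> 'a \<Rightarrow> nat \<Rightarrow> complex^'n" where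
  "data_matrix N x \<omega> = (\<lambda>t\<in>{..<N}. x t \<omega>)"

end

theory Submission
  imports Defs
begin

text \<open>Orthogonal projections that sum to the identity have mutually orthogonal ranges, so unions of
  orthonormal bases of the generalized eigenspaces are orthonormal bases of the whole space. In any
  orthonormal basis the coordinates of a standard complex normal vector are i.i.d., by invariance of
  Lebesgue measure under unitary maps. Each \<open>B_proc\<close> is a function of the noise coordinates along
  its own eigenspace, and these groups of coordinates are disjoint. Geometric multiplicity 1 bounds
  the dimension of each generalized eigenspace by the algebraic multiplicity; since the dimensions
  sum to \<open>CARD('n)\<close> and the multiplicities to at most the degree of the characteristic polynomial,
  both agree.\<close>

subsection \<open>Generalized eigenspaces and the characteristic polynomial\<close>

text \<open>Independence has two sources: over time it is assumed, over orthonormal directions it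
  comes from the Gaussian density. The two have to be merged into one jointly independent family of
  scalars indexed by pairs (time, direction) before anything can be regrouped by eigenspace. The
  regrouping then yields independence of whole trajectories, jointly in all subsystems, and the
  pairwise claim at a fixed time is a single column of it. The dimension count relies on neither the
  Jordan form nor the Cayley-Hamilton theorem: applying a map once more enlarges the kernel by at
  most the dimension of the kernel of that map.\<close>

lemma dim_le_dim_image_plus_kernel:
  fixes A :: "'a::field^'n^'m"
  assumes "vec.subspace V"
  shows "vec.dim V \<le> vec.dim ((*v) A ` V) + vec.dim {v \<in> V. A *v v = 0}"
proof -
  obtain B where B: "B \<subseteq> {v \<in> V. A *v v = 0}" "vec.independent B"
      "{v \<in> V. A *v v = 0} \<subseteq> vec.span B" "card B = vec.dim {v \<in> V. A *v v = 0}"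
    using vec.basis_exists by blast
  obtain E where E: "E \<subseteq> (*v) A ` V" "vec.independent E"
      "(*v) A ` V \<subseteq> vec.span E" "card E = vec.dim ((*v) A ` V)"
    using vec.basis_exists by blast
  have finE: "finite E" and finB: "finite B"
    using E(2) B(2) vec.finiteI_independent by blast+
  obtain D where D0: "D \<subseteq> V" "inj_on ((*v) A) D" "E = (*v) A ` D"
    using E(1) unfolding subset_image_inj by blast
  then have D: "D \<subseteq> V" "finite D" "(*v) A ` D = E" "card D = card E"
    using finE by (auto simp: card_image dest: finite_imageD)
  \<comment> \<open>Half of rank-nullity: \<open>B\<close> is a basis of the kernel and
    \<open>D\<close> lifts a basis of the image. Subtracting from \<open>v\<close> a combination of
    \<open>D\<close> with the same image leaves a kernel vector.\<close>
  have "V \<subseteq> vec.span (B \<union> D)"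
  proof
    fix v assume v: "v \<in> V"
    then have "A *v v \<in> vec.span ((*v) A ` D)" using E(3) D(3) by auto
    then have "A *v v \<in> (*v) A ` vec.span D" by (simp add: vec.span_image)
    then obtain d where d: "d \<in> vec.span D" "A *v v = A *v d" by auto
    have dV: "d \<in> V" using d(1) D(1) assms vec.span_minimal by blast
    have "v - d \<in> {v \<in> V. A *v v = 0}"
      using v dV assms d(2) by (auto intro: vec.subspace_diff simp: matrix_vector_mult_diff_distrib)
    then have "v - d \<in> vec.span (B \<union> D)"
      using B(3) vec.span_mono[of B "B \<union> D"] by auto
    moreover have "d \<in> vec.span (B \<union> D)" using d(1) vec.span_mono[of D "B \<union> D"] by auto
    ultimately show "v \<in> vec.span (B \<union> D)" using vec.span_add by fastforce
  qed
  then have "vec.dim V \<le> card (B \<union> D)"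
    using finB D(2) by (intro vec.dim_le_card) auto
  also have "\<dots> \<le> card B + card D" by (rule card_Un_le)
  finally show ?thesis using B(4) E(4) D(4) by linarith
qed

lemma linear_funpow:
  assumes "Vector_Spaces.linear (*s) (*s) f"
  shows "Vector_Spaces.linear (*s) (*s) ((f :: 'a::field^'n \<Rightarrow> 'a^'n) ^^ k)"
proof (induction k)
  case 0
  then show ?case using vec.linear_id by (simp add: id_def)
next
  case (Suc k)
  then show ?case using Vector_Spaces.linear_compose[OF Suc assms] by (simp add: o_def)
qed

text \<open>\<open>A\<close> maps the kernel of iterate \<open>Suc k\<close> into that of iterate
  \<open>k\<close>, and what it kills there lies in its own kernel, so each iterate adds at most the
  dimension of that kernel.\<close>

lemma dim_kernel_funpow_le:
  fixes A :: "'a::field^'n^'n"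
  shows "vec.dim {v. (((*v) A) ^^ k) v = 0} \<le> k * vec.dim {v. A *v v = 0}"
proof (induction k)
  case 0
  then show ?case by simp
next
  case (Suc k)
  let ?V = "{v. (((*v) A) ^^ Suc k) v = 0}"
  have sub: "vec.subspace ?V"
    using vec.linear_subspace_kernel[OF linear_funpow[OF matrix_vector_mul_linear_gen, of "Suc k" A]] by simp
  have "vec.dim ((*v) A ` ?V) \<le> vec.dim {v. (((*v) A) ^^ k) v = 0}"
    by (rule vec.dim_subset) (auto simp: funpow_swap1)
  moreover have "vec.dim {v \<in> ?V. A *v v = 0} \<le> vec.dim {v. A *v v = 0}"
    by (rule vec.dim_subset) auto
  ultimately show ?case
    using dim_le_dim_image_plus_kernel[OF sub, of A] Suc by simp
qed

lemma funpow_commute: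
  assumes "\<And>v. f (g v) = g (f v)"
  shows "(g ^^ k) (f v) = f ((g ^^ k) v)"
  by (induction k) (simp_all add: assms)

lemma mat_vector_mul: "mat c *v v = c *s v"
  for v :: "'a::comm_semiring_1^'n"
  by (simp add: vec_eq_iff matrix_vector_mult_def mat_def if_distrib if_distribR cong: if_cong)

lemma subspace_gen_eigenspace: "vec.subspace (gen_eigenspace A c)"
  unfolding gen_eigenspace_def
  by (rule vec.linear_subspace_kernel[OF linear_funpow[OF matrix_vector_mul_linear_gen]])

lemma gen_eigenspace_invariant:
  assumes "v \<in> gen_eigenspace A c"
  shows "A *v v \<in> gen_eigenspace A c"
proof -
  have "A *v ((A - mat c) *v u) = (A - mat c) *v (A *v u)" for u
    by (simp add: matrix_vector_mult_diff_rdistrib matrix_vector_mult_diff_distrib mat_vector_mul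
        vector_scalar_commute)
  then have "((\<lambda>u. (A - mat c) *v u) ^^ k) (A *v v) = A *v (((\<lambda>u. (A - mat c) *v u) ^^ k) v)"
    for k by (rule funpow_commute)
  then show ?thesis using assms by (simp add: gen_eigenspace_def)
qed

section \<open>Roots and degree of the characteristic polynomial\<close>

lemma poly_of_charpoly: "poly (charpoly A) z = det (mat z - A)"
proof -
  have "poly (of_int k) z = of_int k" for k
    by (simp add: of_int_poly)
  moreover have "poly ((mat [:0, 1:] - map_matrix (\<lambda>a. [:a:]) A) $ i $ j) z = (mat z - A) $ i $ j"
    for i j
    by (simp add: mat_def map_matrix_def)
  ultimately show ?thesis
    unfolding charpoly_def det_def by (simp add: poly_sum poly_prod)
qed

text \<open>A Leibniz term is a constant sign times one entry per row, each of degree at most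
  1.\<close>

lemma degree_charpoly_le: "degree (charpoly (A :: complex^'n^'n)) \<le> CARD('n)"
  unfolding charpoly_def det_def
proof (rule degree_sum_le)
  let ?C = "mat [:0, 1:] - map_matrix (\<lambda>a. [:a:]) A"
  fix p :: "'n \<Rightarrow> 'n"
  have "degree (of_int (sign p) * (\<Prod>i\<in>UNIV. ?C $ i $ p i)) \<le> degree (\<Prod>i\<in>UNIV. ?C $ i $ p i)"
    using degree_mult_le[of "of_int (sign p)" "\<Prod>i\<in>UNIV. ?C $ i $ p i"] by simp
  also have "\<dots> \<le> (\<Sum>i\<in>(UNIV::'n set). degree (?C $ i $ p i))"
    using degree_prod_sum_le[of UNIV "\<lambda>i. ?C $ i $ p i"] by (simp add: o_def)
  also have "\<dots> \<le> (\<Sum>i\<in>(UNIV::'n set). 1)"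
    by (rule sum_mono) (simp add: mat_def map_matrix_def)
  finally show "degree (of_int (sign p) * (\<Prod>i\<in>UNIV. ?C $ i $ p i)) \<le> CARD('n)" by simp
qed simp

lemma eigenvalue_iff_root: "eigenvalue A c \<longleftrightarrow> poly (charpoly A) c = 0"
proof -
  have "det (mat c - A) \<noteq> 0 \<longleftrightarrow> (\<forall>v. (mat c - A) *v v = 0 \<longrightarrow> v = 0)"
    by (metis invertible_det_nz invertible_left_inverse matrix_left_invertible_ker)
  moreover have "(mat c - A) *v v = 0 \<longleftrightarrow> A *v v = c *s v" for v
    by (auto simp: matrix_vector_mult_diff_rdistrib mat_vector_mul)
  ultimately show ?thesis by (auto simp: eigenvalue_def poly_of_charpoly)
qed

lemma sum_alg_mult_le:
  assumes "charpoly (A :: complex^'n^'n) \<noteq> 0" "finite S"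
  shows "(\<Sum>c\<in>S. alg_mult A c) \<le> CARD('n)"
proof -
  have "(\<Sum>c\<in>S. alg_mult A c) = (\<Sum>c\<in>S. count (proots (charpoly A)) c)"
    using assms by (simp add: alg_mult_def)
  \<comment> \<open>\<open>S\<close> may contain non-roots and may miss roots. Passing to the union
    only adds terms, and the non-roots then drop out with count 0.\<close>
  also have "\<dots> \<le> (\<Sum>c\<in>S \<union> set_mset (proots (charpoly A)). count (proots (charpoly A)) c)"
    using assms(2) by (intro sum_mono2) auto
  also have "\<dots> = size (proots (charpoly A))"
    unfolding size_multiset_overloaded_eq using assms(2)
    by (intro sum.mono_neutral_right) (auto simp: not_in_iff simp del: set_count_proots)
  also have "\<dots> \<le> CARD('n)"
    using size_proots_le degree_charpoly_le order_trans by blast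
  finally show ?thesis .
qed

lemma dim_gen_eigenspace_le: "vec.dim (gen_eigenspace A c) \<le> alg_mult A c * geo_mult A c"
  unfolding gen_eigenspace_def geo_mult_def by (rule dim_kernel_funpow_le)

subsection \<open>Hermitian orthonormal sets\<close>

lemma cinner_add_left: "cinner (x + y) z = cinner x z + cinner y z"
  by (simp add: cinner_def algebra_simps sum.distrib)

lemma cinner_add_right: "cinner x (y + z) = cinner x y + cinner x z"
  by (simp add: cinner_def algebra_simps sum.distrib)

lemma cinner_diff_left: "cinner (x - y) z = cinner x z - cinner y z"
  by (simp add: cinner_def algebra_simps sum_subtractf)

lemma cinner_scale_left: "cinner (c *s x) z = c * cinner x z"
  by (simp add: cinner_def algebra_simps sum_distrib_left)

lemma cinner_scale_right: "cinner x (c *s z) = cnj c * cinner x z"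
  by (simp add: cinner_def algebra_simps sum_distrib_left)

lemma cinner_commute: "cinner x y = cnj (cinner y x)"
  by (simp add: cinner_def mult.commute)

lemma cinner_zero_left [simp]: "cinner 0 z = 0"
  by (simp add: cinner_def)

lemma cinner_zero_right [simp]: "cinner z 0 = 0"
  by (simp add: cinner_def)

lemma cinner_sum_left: "cinner (\<Sum>i\<in>I. f i) z = (\<Sum>i\<in>I. cinner (f i) z)"
  by (induction I rule: infinite_finite_induct) (simp_all add: cinner_add_left)

lemma cinner_self: "cinner x x = of_real ((norm x)\<^sup>2)"
  by (simp add: cinner_def norm_vec_def L2_set_def sum_nonneg complex_norm_square
      flip: of_real_power)

lemma cinner_self_eq_0_iff: "cinner x x = 0 \<longleftrightarrow> x = 0"
  by (simp add: cinner_self)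

text \<open>A notion for sets, unlike the enumerated \<open>orthonormal_basis\<close>, so that
  \<open>vec.span\<close>, \<open>vec.independent\<close> and unions over eigenspaces apply
  directly.\<close>

definition orthonormal_set :: "(complex^'n) set \<Rightarrow> bool" where
  "orthonormal_set S \<longleftrightarrow> (\<forall>x\<in>S. \<forall>y\<in>S. cinner x y = (if x = y then 1 else 0))"

lemma cinner_orthonormal_combination:
  assumes "orthonormal_set S" "finite T" "T \<subseteq> S" "s \<in> S"
  shows "cinner (\<Sum>t\<in>T. a t *s t) s = (if s \<in> T then a s else 0)"
proof -
  have "cinner (\<Sum>t\<in>T. a t *s t) s = (\<Sum>t\<in>T. if t = s then a t else 0)"
    using assms unfolding cinner_sum_left cinner_scale_left orthonormal_set_def
    by (intro sum.cong) auto
  also have "\<dots> = (if s \<in> T then a s else 0)"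
    using assms(2) by simp
  finally show ?thesis .
qed

lemma independent_orthonormal:
  assumes "orthonormal_set S"
  shows "vec.independent S"
  unfolding vec.dependent_explicit
proof (safe, goal_cases)
  case (1 T a v)
  then have "cinner (\<Sum>t\<in>T. a t *s t) v = a v"
    using cinner_orthonormal_combination[OF assms, of T v a] by auto
  then show ?case using 1 by simp
qed

lemma finite_orthonormal: "orthonormal_set S \<Longrightarrow> finite S"
  using independent_orthonormal vec.finiteI_independent by blast

text \<open>For orthonormal \<open>T\<close> this is the explicit form of the orthogonal projection
  onto the span of \<open>T\<close>, replacing the definite description in
  \<open>orth_proj\<close>.\<close>

definition fourier_sum :: "(complex^'n) set \<Rightarrow> complex^'n \<Rightarrow> complex^'n" where
  "fourier_sum T x = (\<Sum>t\<in>T. cinner x t *s t)"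

lemma fourier_sum_in_span: "fourier_sum T x \<in> vec.span T"
  unfolding fourier_sum_def by (intro vec.span_sum vec.span_scale vec.span_base)

lemma cinner_fourier_residual:
  assumes "orthonormal_set T" "z \<in> vec.span T"
  shows "cinner (x - fourier_sum T x) z = 0"
  using assms(2)
proof (induction rule: vec.span_induct_alt)
  case (step c z y)
  then have "cinner (x - fourier_sum T x) z = 0"
    using cinner_orthonormal_combination[OF assms(1) finite_orthonormal[OF assms(1)], of z]
    by (simp add: fourier_sum_def cinner_diff_left)
  then show ?case using step by (simp add: cinner_add_right cinner_scale_right)
qed simp

text \<open>Gram-Schmidt, one vector at a time: a vector of \<open>V\<close> outside the span has a
  nonzero Fourier residual, which is normalized and added.\<close>

lemma orthonormal_extension:
  assumes "vec.subspace V" "orthonormal_set S" "S \<subseteq> V"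
  obtains T where "S \<subseteq> T" "orthonormal_set T" "vec.span T = V"
proof -
  have "\<exists>T. S \<subseteq> T \<and> orthonormal_set T \<and> vec.span T = V"
    using assms(2,3)
  proof (induction "vec.dim V - card S" arbitrary: S rule: less_induct)
    case less
    note fin = finite_orthonormal[OF less.prems(1)]
    have sp: "vec.span S \<subseteq> V" using less.prems(2) assms(1) by (rule vec.span_minimal)
    show ?case
    proof (cases "vec.span S = V")
      case True
      then show ?thesis using less.prems by blast
    next
      case False
      then obtain v where v: "v \<in> V" "v \<notin> vec.span S" using sp by blast
      define r where "r = v - fourier_sum S v"
      define u where "u = complex_of_real (1 / norm r) *s r"
      have r0: "r \<noteq> 0" using v(2) fourier_sum_in_span[of S v] by (auto simp: r_def)
      have rV: "r \<in> V" unfolding r_def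
        using v(1) fourier_sum_in_span[of S v] sp by (intro vec.subspace_diff[OF assms(1)]) auto
      have "cinner u u = of_real (1 / norm r) * (of_real (1 / norm r) * of_real ((norm r)\<^sup>2))"
        by (simp only: u_def cinner_scale_left cinner_scale_right cinner_self[of r]
            complex_cnj_complex_of_real)
      also have "\<dots> = 1" using r0 by (simp add: power2_eq_square)
      finally have uu: "cinner u u = 1" .
      have us: "cinner u s = 0" if "s \<in> S" for s
        using cinner_fourier_residual[OF less.prems(1), of s v] that
        by (simp add: u_def cinner_scale_left vec.span_base flip: r_def)
      then have su: "cinner s u = 0" if "s \<in> S" for s
        using that by (subst cinner_commute) simp
      have uS: "u \<notin> S" using us uu by force
      have ort: "orthonormal_set (insert u S)"
        using less.prems(1) uu us su uS unfolding orthonormal_set_def by auto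
      have sub: "insert u S \<subseteq> V"
        using less.prems(2) rV by (auto simp: u_def intro: vec.subspace_scale[OF assms(1)])
      \<comment> \<open>Subtraction on the naturals is truncated; the measure drops only because the
        enlarged set still has at most \<open>vec.dim V\<close> elements.\<close>
      have "card (insert u S) \<le> vec.dim V"
        using vec.independent_card_le_dim[OF sub independent_orthonormal[OF ort]] .
      then have "vec.dim V - card (insert u S) < vec.dim V - card S"
        using uS fin by simp
      from less.hyps[OF this ort sub] show ?thesis by blast
    qed
  qed
  then show ?thesis using that by blast
qed

lemma orthonormal_basis_set:
  assumes "vec.subspace V"
  obtains T where "orthonormal_set T" "vec.span T = V"
  using orthonormal_extension[OF assms, of "{}"] vec.subspace_0[OF assms]
  by (auto simp: orthonormal_set_def)

lemma card_orthonormal: "orthonormal_set T \<Longrightarrow> vec.dim (vec.span T) = card T"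
  using independent_orthonormal vec.dim_span_eq_card_independent by blast

text \<open>Existence is the Fourier residual property. For uniqueness, two candidates differ by a
  vector of the span that is orthogonal to the span, hence to itself.\<close>

lemma orth_proj_fourier:
  assumes "orthonormal_set T"
  shows "orth_proj (vec.span T) x = fourier_sum T x"
  unfolding orth_proj_def
proof (rule the_equality)
  fix y assume y: "y \<in> vec.span T \<and> (\<forall>z\<in>vec.span T. cinner (x - y) z = 0)"
  let ?d = "y - fourier_sum T x"
  have "?d \<in> vec.span T" using y fourier_sum_in_span by (auto intro: vec.span_diff)
  moreover have "cinner ?d z = cinner (x - fourier_sum T x) z - cinner (x - y) z" for z
    by (simp add: cinner_diff_left)
  ultimately have "cinner ?d ?d = 0" using y cinner_fourier_residual[OF assms] by simp
  then show "y = fourier_sum T x" by (simp add: cinner_self_eq_0_iff)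
qed (use fourier_sum_in_span cinner_fourier_residual[OF assms] in auto)

text \<open>Every subspace has an orthonormal basis, so the definite description is well defined and
  its algebra can be read off from the Fourier sum.\<close>

lemma
  assumes "vec.subspace V"
  shows orth_proj_in: "orth_proj V x \<in> V"
    and cinner_orth_proj_residual: "z \<in> V \<Longrightarrow> cinner (x - orth_proj V x) z = 0"
    and orth_proj_add: "orth_proj V (x + y) = orth_proj V x + orth_proj V y"
    and orth_proj_scale: "orth_proj V (c *s x) = c *s orth_proj V x"
    and orth_proj_id: "x \<in> V \<Longrightarrow> orth_proj V x = x"
proof -
  obtain T where T: "orthonormal_set T" "vec.span T = V"
    using assms by (rule orthonormal_basis_set)
  note eq = orth_proj_fourier[OF T(1), unfolded T(2)]
  show *: "orth_proj V x \<in> V" for x using eq fourier_sum_in_span T(2) by auto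
  show **: "z \<in> V \<Longrightarrow> cinner (x - orth_proj V x) z = 0" for x z
    using eq cinner_fourier_residual[OF T(1)] T(2) by auto
  show "orth_proj V (x + y) = orth_proj V x + orth_proj V y"
    by (simp add: eq fourier_sum_def cinner_add_left sum.distrib
        vec.scale_left_distrib)
  show "orth_proj V (c *s x) = c *s orth_proj V x"
    by (simp add: eq fourier_sum_def cinner_scale_left vec.scale_sum_right)
  show "x \<in> V \<Longrightarrow> orth_proj V x = x"
    using **[of "x - orth_proj V x" x] * assms
    by (simp add: vec.subspace_diff cinner_self_eq_0_iff)
qed

lemma linear_orth_proj:
  assumes "vec.subspace V"
  shows "Vector_Spaces.linear (*s) (*s) (orth_proj V)"
  by unfold_locales (simp_all add: orth_proj_add[OF assms] orth_proj_scale[OF assms])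

text \<open>If orthogonal projections sum to the identity, then for \<open>v \<in> V j\<close> the identity
  \<open>(norm v)\<^sup>2 = (\<Sum>m. (norm (P m v))\<^sup>2)\<close> has the term \<open>(norm v)\<^sup>2\<close> on the right, so all other
  projections of \<open>v\<close> vanish.\<close>

lemma resolution_orthogonal:
  fixes V :: "'i \<Rightarrow> (complex^'n) set"
  assumes fin: "finite I" and sub: "\<And>i. i \<in> I \<Longrightarrow> vec.subspace (V i)"
    and res: "\<And>v. (\<Sum>i\<in>I. orth_proj (V i) v) = v"
    and ij: "i \<in> I" "j \<in> I" "i \<noteq> j" and u: "u \<in> V i" and v: "v \<in> V j"
  shows "cinner u v = 0"
proof -
  have pyth: "cinner (orth_proj (V k) v) v = of_real ((norm (orth_proj (V k) v))\<^sup>2)"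
    if "k \<in> I" for k
  proof -
    let ?p = "orth_proj (V k) v"
    have "cinner (v - ?p) ?p = 0"
      using cinner_orth_proj_residual orth_proj_in sub that by blast
    then have "cinner v ?p = cinner ?p ?p" by (simp add: cinner_diff_left)
    then have "cinner ?p v = cnj (cinner ?p ?p)" by (subst cinner_commute) simp
    then show ?thesis by (simp add: cinner_self)
  qed
  have "of_real ((norm v)\<^sup>2) = cinner (\<Sum>k\<in>I. orth_proj (V k) v) v"
    by (simp add: res cinner_self)
  also have "\<dots> = of_real (\<Sum>k\<in>I. (norm (orth_proj (V k) v))\<^sup>2)"
    by (simp add: cinner_sum_left pyth)
  finally have "(norm v)\<^sup>2 = (\<Sum>k\<in>I. (norm (orth_proj (V k) v))\<^sup>2)"
    using of_real_eq_iff by blast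
  also have "\<dots> = (norm v)\<^sup>2 + (\<Sum>k\<in>I - {j}. (norm (orth_proj (V k) v))\<^sup>2)"
    using fin ij v sub by (subst sum.remove[of _ j]) (auto simp: orth_proj_id)
  finally have "(\<Sum>k\<in>I - {j}. (norm (orth_proj (V k) v))\<^sup>2) = 0" by simp
  then have "orth_proj (V i) v = 0"
    using fin ij by (auto simp: sum_nonneg_eq_0_iff)
  then have "cinner v u = 0"
    using cinner_orth_proj_residual[OF sub[OF ij(1)] u, of v] by simp
  then show ?thesis by (subst cinner_commute) simp
qed

text \<open>The resolution of the identity acts twice: through \<open>resolution_orthogonal\<close>
  it makes bases of different \<open>V i\<close> orthogonal, and it puts every vector into the span
  of their union. Counting that union gives the sum of dimensions.\<close>

lemma resolution_orthonormal_basis: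
  fixes V :: "'i \<Rightarrow> (complex^'n) set"
  assumes fin: "finite I" and sub: "\<And>i. i \<in> I \<Longrightarrow> vec.subspace (V i)"
    and res: "\<And>v. (\<Sum>i\<in>I. orth_proj (V i) v) = v"
  obtains T where "\<And>i. i \<in> I \<Longrightarrow> orthonormal_set (T i)" "\<And>i. i \<in> I \<Longrightarrow> vec.span (T i) = V i"
    "disjoint_family_on T I" "orthonormal_set (\<Union>i\<in>I. T i)" "(\<Sum>i\<in>I. vec.dim (V i)) = CARD('n)"
proof -
  have "\<forall>i\<in>I. \<exists>T. orthonormal_set T \<and> vec.span T = V i"
    using orthonormal_basis_set sub by metis
  then obtain T where T: "\<And>i. i \<in> I \<Longrightarrow> orthonormal_set (T i)" "\<And>i. i \<in> I \<Longrightarrow> vec.span (T i) = V i"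
    by metis
  have TV: "T i \<subseteq> V i" if "i \<in> I" for i using T(2)[OF that] vec.span_superset by blast
  have orth: "cinner u v = 0" if "i \<in> I" "j \<in> I" "i \<noteq> j" "u \<in> T i" "v \<in> T j" for i j u v
    using resolution_orthogonal[OF fin sub res that(1-3)] that TV by blast
  \<comment> \<open>A common member would be a unit vector orthogonal to itself.\<close>
  have disj: "T i \<inter> T j = {}" if "i \<in> I" "j \<in> I" "i \<noteq> j" for i j
  proof (rule ccontr)
    assume "T i \<inter> T j \<noteq> {}"
    then obtain u where "u \<in> T i" "u \<in> T j" by blast
    moreover have "cinner u u = 1" using T(1)[OF that(1)] \<open>u \<in> T i\<close> by (simp add: orthonormal_set_def)
    ultimately show False using orth[OF that] by simp
  qed
  have ons: "orthonormal_set (\<Union>i\<in>I. T i)"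
    unfolding orthonormal_set_def
  proof (intro ballI)
    fix x y assume "x \<in> (\<Union>i\<in>I. T i)" "y \<in> (\<Union>i\<in>I. T i)"
    then obtain i j where ij: "i \<in> I" "x \<in> T i" "j \<in> I" "y \<in> T j" by blast
    show "cinner x y = (if x = y then 1 else 0)"
    proof (cases "i = j")
      case True
      then show ?thesis using T(1) ij unfolding orthonormal_set_def by blast
    next
      case False
      then show ?thesis using orth ij disj by fastforce
    qed
  qed
  have "v \<in> vec.span (\<Union>i\<in>I. T i)" for v
  proof -
    have "(\<Sum>i\<in>I. orth_proj (V i) v) \<in> vec.span (\<Union>i\<in>I. T i)"
    proof (rule vec.span_sum)
      fix i assume i: "i \<in> I"
      have "vec.span (T i) \<subseteq> vec.span (\<Union>i\<in>I. T i)" using i by (intro vec.span_mono) auto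
      then show "orth_proj (V i) v \<in> vec.span (\<Union>i\<in>I. T i)"
        using orth_proj_in[OF sub[OF i]] T(2)[OF i] by blast
    qed
    then show ?thesis by (simp add: res)
  qed
  then have "vec.span (\<Union>i\<in>I. T i) = UNIV" by blast
  then have "CARD('n) = card (\<Union>i\<in>I. T i)"
    using card_orthonormal[OF ons] by (simp add: vec.dim_UNIV card_cart_basis)
  also have "\<dots> = (\<Sum>i\<in>I. card (T i))"
    using fin disj finite_orthonormal[OF T(1)] by (intro card_UN_disjoint) auto
  also have "\<dots> = (\<Sum>i\<in>I. vec.dim (V i))"
    using card_orthonormal[OF T(1)] T(2) by (intro sum.cong) auto
  finally have "(\<Sum>i\<in>I. vec.dim (V i)) = CARD('n)" by simp
  then show ?thesis
    using disj by (intro that[of T] T ons) (auto simp: disjoint_family_on_def)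
qed

subsection \<open>Lebesgue measure and unitary maps\<close>

lemma nn_integral_lborel_translate:
  fixes a :: "'a::euclidean_space"
  assumes [measurable]: "g \<in> borel_measurable borel"
  shows "(\<integral>\<^sup>+y. g (y - a) \<partial>lborel) = (\<integral>\<^sup>+y. g y \<partial>lborel)"
proof -
  have "(\<integral>\<^sup>+y. g y \<partial>lborel) = (\<integral>\<^sup>+y. g y \<partial>distr lborel borel ((+) (- a)))"
    by (simp only: lborel_distr_plus)
  also have "\<dots> = (\<integral>\<^sup>+y. g (y - a) \<partial>lborel)"
    by (subst nn_integral_distr) auto
  finally show ?thesis ..
qed

lemma nn_integral_lborel_reflect:
  fixes a :: "'a::euclidean_space"
  assumes [measurable]: "g \<in> borel_measurable borel"
  shows "(\<integral>\<^sup>+y. g (a - y) \<partial>lborel) = (\<integral>\<^sup>+y. g y \<partial>lborel)"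
proof -
  have "(\<integral>\<^sup>+y. g y \<partial>lborel) = (\<integral>\<^sup>+y. g y \<partial>distr lborel borel (\<lambda>x. a - x))"
    using lborel_affine[of "-1" a] by (simp add: density_1)
  also have "\<dots> = (\<integral>\<^sup>+y. g (a - y) \<partial>lborel)"
    by (subst nn_integral_distr) auto
  finally show ?thesis ..
qed

text \<open>Integrate \<open>indicator A (f x) * indicator B (y - f x)\<close> in both orders, \<open>B\<close> being the unit
  ball. For \<open>y = f z\<close>, the reflection of \<open>x\<close> to \<open>z - x\<close> exchanges the roles of \<open>A\<close> and \<open>B\<close>;
  since \<open>B\<close> is \<open>f\<close>-invariant with positive finite measure, its measure cancels.\<close>

lemma lborel_distr_linear_isometry:
  fixes f :: "'a::euclidean_space \<Rightarrow> 'a"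
  assumes lin: "linear f" and iso: "\<And>x. norm (f x) = norm x"
  shows "distr lborel borel f = lborel"
proof (rule measure_eqI)
  have [measurable]: "f \<in> borel_measurable borel"
    using lin by (intro borel_measurable_continuous_onI linear_continuous_on)
      (simp add: linear_conv_bounded_linear)
  have inj: "inj f"
    using lin iso by (metis linear_injective_0 norm_eq_zero)
  then have surj: "surj f" using lin linear_injective_imp_surjective by blast
  fix A assume "A \<in> sets (distr lborel borel f)"
  then have A [measurable]: "A \<in> sets borel" by simp
  have [measurable]: "ball (0::'a) 1 \<in> sets borel" by simp
  let ?a = "indicator A :: 'a \<Rightarrow> ennreal"
  let ?b = "indicator (ball 0 1) :: 'a \<Rightarrow> ennreal"
  have bf: "?b (f x) = ?b x" for x by (simp add: indicator_def iso)
  define v where "v = emeasure lborel (ball (0::'a) 1)"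
  have v: "v \<noteq> 0" "v \<noteq> \<top>" using emeasure_ball[of 1 "0::'a"] by (auto simp: v_def ennreal_eq_0_iff not_le)
  have trb: "(\<integral>\<^sup>+y. ?b (y - a) \<partial>lborel) = v" for a
    using nn_integral_lborel_translate[of ?b a] by (simp add: v_def borel_measurable_indicator)
  have tra: "(\<integral>\<^sup>+y. ?a (y - a) \<partial>lborel) = emeasure lborel A" for a
    using nn_integral_lborel_translate[of ?a a] by (simp add: borel_measurable_indicator)
  have "emeasure (distr lborel borel f) A * v
      = (\<integral>\<^sup>+x. ?a (f x) \<partial>lborel) * v"
    by (simp add: nn_integral_distr flip: nn_integral_indicator)
  also have "\<dots> = (\<integral>\<^sup>+x. ?a (f x) * (\<integral>\<^sup>+y. ?b (y - f x) \<partial>lborel) \<partial>lborel)"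
    by (simp only: trb) (simp add: nn_integral_multc)
  also have "\<dots> = (\<integral>\<^sup>+x. (\<integral>\<^sup>+y. ?a (f x) * ?b (y - f x) \<partial>lborel) \<partial>lborel)"
    by (intro nn_integral_cong nn_integral_cmult[symmetric]) measurable
  also have "\<dots> = (\<integral>\<^sup>+y. (\<integral>\<^sup>+x. ?a (f x) * ?b (y - f x) \<partial>lborel) \<partial>lborel)"
    by (rule lborel_pair.Fubini'[symmetric]) measurable
  also have "\<dots> = (\<integral>\<^sup>+y. (\<integral>\<^sup>+x. ?a (y - f x) * ?b (f x) \<partial>lborel) \<partial>lborel)"
  proof (rule nn_integral_cong)
    fix y :: 'a
    obtain z where z: "y = f z" using surj by blast
    have "(\<integral>\<^sup>+x. ?a (f x) * ?b (y - f x) \<partial>lborel)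
        = (\<integral>\<^sup>+x. ?a (f (z - x)) * ?b (y - f (z - x)) \<partial>lborel)"
      by (rule nn_integral_lborel_reflect[symmetric, of "\<lambda>x. ?a (f x) * ?b (y - f x)" z]) measurable
    also have "\<dots> = (\<integral>\<^sup>+x. ?a (y - f x) * ?b (f x) \<partial>lborel)"
      by (simp add: linear_diff[OF lin] z)
    finally show "(\<integral>\<^sup>+x. ?a (f x) * ?b (y - f x) \<partial>lborel)
        = (\<integral>\<^sup>+x. ?a (y - f x) * ?b (f x) \<partial>lborel)" .
  qed
  also have "\<dots> = (\<integral>\<^sup>+x. (\<integral>\<^sup>+y. ?a (y - f x) * ?b (f x) \<partial>lborel) \<partial>lborel)"
    by (rule lborel_pair.Fubini') measurable
  also have "\<dots> = (\<integral>\<^sup>+x. emeasure lborel A * ?b x \<partial>lborel)"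
  proof (rule nn_integral_cong)
    fix x
    have "(\<integral>\<^sup>+y. ?a (y - f x) * ?b (f x) \<partial>lborel) = (\<integral>\<^sup>+y. ?a (y - f x) \<partial>lborel) * ?b (f x)"
      by (rule nn_integral_multc) measurable
    then show "(\<integral>\<^sup>+y. ?a (y - f x) * ?b (f x) \<partial>lborel) = emeasure lborel A * ?b x"
      by (simp only: tra bf)
  qed
  also have "\<dots> = emeasure lborel A * v"
    by (simp add: nn_integral_cmult v_def)
  finally show "emeasure (distr lborel borel f) A = emeasure lborel A"
    using v by (metis mult_divide_eq_ennreal)
qed simp

section \<open>Lebesgue measure on vectors as a product measure\<close>

lemma borel_measurable_vec_nth [measurable]:
  "(\<lambda>z. z $ i) \<in> borel_measurable (borel :: ('a::euclidean_space^'n) measure)"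
  by (intro borel_measurable_continuous_onI continuous_intros)

lemma measurable_vec_lambda_PiM [measurable]:
  "(\<lambda>f. \<chi> i. f i) \<in> (\<Pi>\<^sub>M i\<in>(UNIV::'n::finite set). (borel :: 'a::euclidean_space measure)) \<rightarrow>\<^sub>M borel"
  by (subst borel_measurable_euclidean_space) (auto simp: Basis_vec_def inner_axis)

lemma prod_Basis_vec:
  fixes g :: "'a::euclidean_space^'n \<Rightarrow> 'b::comm_monoid_mult"
  shows "(\<Prod>b\<in>Basis. g b) = (\<Prod>i\<in>UNIV. \<Prod>u\<in>Basis. g (axis i u))"
proof -
  have "(\<Prod>i\<in>UNIV. \<Prod>u\<in>Basis. g (axis i u)) = (\<Prod>(i,u)\<in>UNIV \<times> Basis. g (axis i u))"
    by (simp add: prod.cartesian_product)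
  also have "\<dots> = (\<Prod>b\<in>Basis. g b)"
  proof -
    have "bij_betw (\<lambda>(i, u). axis i u) (UNIV \<times> Basis) (Basis :: ('a^'n) set)"
      by (auto simp: bij_betw_def inj_on_def Basis_vec_def axis_eq_axis image_iff)
    from prod.reindex_bij_betw[OF this, of g] show ?thesis by (simp add: case_prod_unfold)
  qed
  finally show ?thesis ..
qed

text \<open>Lebesgue measure is determined by the volumes of boxes, and a box in
  \<open>'a^'n\<close> pulls back to a product of boxes in the coordinate spaces, which may
  themselves have several real dimensions.\<close>

lemma lborel_vec_eq_distr_PiM:
  "(lborel :: ('a::euclidean_space^'n) measure)
    = distr (\<Pi>\<^sub>M i\<in>(UNIV::'n set). lborel) borel (\<lambda>f. \<chi> i. f i)"
proof (rule lborel_eqI)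
  interpret product_sigma_finite "\<lambda>_::'n. lborel :: 'a measure" ..
  let ?P = "\<Pi>\<^sub>M i\<in>(UNIV::'n set). (lborel :: 'a measure)"
  have [measurable]: "(\<lambda>f. \<chi> i. f i) \<in> ?P \<rightarrow>\<^sub>M borel"
    using measurable_vec_lambda_PiM by (simp cong: measurable_cong_sets sets_PiM_cong)
  fix l u :: "'a^'n"
  assume le: "\<And>b. b \<in> Basis \<Longrightarrow> l \<bullet> b \<le> u \<bullet> b"
  have le': "l $ i \<bullet> b \<le> u $ i \<bullet> b" if "b \<in> Basis" for i b
    using le[of "axis i b"] that by (auto simp: Basis_vec_def inner_axis)
  have "(\<lambda>f. \<chi> i. f i) -` box l u \<inter> space ?P = (\<Pi>\<^sub>E i\<in>UNIV. box (l $ i) (u $ i))"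
    by (auto simp: space_PiM PiE_def box_def Basis_vec_def inner_axis)
  then have "emeasure (distr ?P borel (\<lambda>f. \<chi> i. f i)) (box l u)
      = (\<Prod>i\<in>UNIV. emeasure lborel (box (l $ i) (u $ i)))"
    by (simp add: emeasure_distr emeasure_PiM)
  also have "\<dots> = (\<Prod>i\<in>UNIV. ennreal (\<Prod>b\<in>Basis. (u $ i - l $ i) \<bullet> b))"
    using le' by (intro prod.cong) (simp_all add: emeasure_lborel_box)
  also have "\<dots> = ennreal (\<Prod>b\<in>Basis. (u - l) \<bullet> b)"
    using le' by (simp add: prod_Basis_vec inner_axis prod_ennreal prod_nonneg inner_diff_left)
  finally show "emeasure (distr ?P borel (\<lambda>f. \<chi> i. f i)) (box l u)
      = ennreal (\<Prod>b\<in>Basis. (u - l) \<bullet> b)" .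
qed simp

lemma nn_integral_lborel_vec_prod:
  fixes f :: "'n::finite \<Rightarrow> 'a::euclidean_space \<Rightarrow> ennreal"
  assumes [measurable]: "\<And>i. f i \<in> borel_measurable borel"
  shows "(\<integral>\<^sup>+z. (\<Prod>i\<in>UNIV. f i (z $ i)) \<partial>lborel) = (\<Prod>i\<in>UNIV. \<integral>\<^sup>+y. f i y \<partial>lborel)"
proof -
  interpret product_sigma_finite "\<lambda>_::'n. lborel :: 'a measure" ..
  have [measurable]: "(\<lambda>f. \<chi> i. f i) \<in> (\<Pi>\<^sub>M i\<in>(UNIV::'n set). (lborel :: 'a measure)) \<rightarrow>\<^sub>M borel"
    using measurable_vec_lambda_PiM by (simp cong: measurable_cong_sets sets_PiM_cong)
  show ?thesis
    by (subst lborel_vec_eq_distr_PiM, subst nn_integral_distr)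
      (simp_all add: product_nn_integral_prod)
qed

subsection \<open>Independence\<close>

text \<open>Group into the singleton blocks \<open>{h j}\<close>, disjoint by injectivity, and
  evaluate each block at its only index.\<close>

lemma (in prob_space) indep_vars_reindex:
  assumes "indep_vars M' X (h ` I)" "inj_on h I"
  shows "indep_vars (\<lambda>i. M' (h i)) (\<lambda>i. X (h i)) I"
proof -
  have "indep_vars (\<lambda>j. PiM {h j} M') (\<lambda>j \<omega>. restrict (\<lambda>i. X i \<omega>) {h j}) I"
    using assms by (intro indep_vars_restrict[OF assms(1)])
      (auto simp: disjoint_family_on_def inj_on_def)
  from indep_vars_compose2[OF this, of "\<lambda>j f. f (h j)" "\<lambda>i. M' (h i)"]
  show ?thesis by simp
qed

text \<open>Each sigma-algebra serves as its own intersection-stable generator. Subfamilies are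
  covered by the full product formula, with whole spaces as the remaining sets.\<close>

lemma (in prob_space) indep_vars_finite_sets:
  assumes "finite I" "\<And>i. i \<in> I \<Longrightarrow> random_variable (M' i) (X i)"
    and "\<And>A. (\<And>i. i \<in> I \<Longrightarrow> A i \<in> sets (M' i)) \<Longrightarrow>
      prob (\<Inter>j\<in>I. X j -` A j \<inter> space M) = (\<Prod>j\<in>I. prob (X j -` A j \<inter> space M))"
  shows "indep_vars M' X I"
proof (cases "I = {}")
  case True
  then show ?thesis by (simp add: indep_vars_def2 indep_sets_def)
next
  case False
  have "sets (M' i) = sigma_sets (space (M' i)) (sets (M' i))" for i
    by (simp add: sets.sigma_sets_eq)
  from indep_vars_finite[OF False assms(1) this assms(2)] assms(3)
  show ?thesis
    by (auto simp: Int_stable_def sets.space_closed Pi_iff dest: sets.sets_into_space)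
qed

text \<open>The merging step: the probability of a product event factors first over
  \<open>t\<close>, by independence of the vectors \<open>W t\<close>, and then over
  \<open>k\<close> within each \<open>t\<close>. All \<open>W t\<close> share the space
  \<open>N'\<close> so that the same maps \<open>F k\<close> apply at every time.\<close>

lemma (in prob_space) indep_vars_components:
  assumes W: "indep_vars N W T" and fin: "finite T" "finite I"
    and F: "\<And>k. k \<in> I \<Longrightarrow> F k \<in> N' \<rightarrow>\<^sub>M L k"
    and N: "\<And>t. t \<in> T \<Longrightarrow> N t = N'"
    and comp: "\<And>t. t \<in> T \<Longrightarrow> indep_vars L (\<lambda>k \<omega>. F k (W t \<omega>)) I"
  shows "indep_vars (\<lambda>(t, k). L k) (\<lambda>(t, k) \<omega>. F k (W t \<omega>)) (T \<times> I)"
\<comment> \<open>Empty index sets are split off because an empty intersection is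
  \<open>UNIV\<close> and not \<open>space M\<close>.\<close>
proof (cases "T = {} \<or> I = {}")
  case True
  then show ?thesis by (auto simp: indep_vars_def2 indep_sets_def)
next
  case False
  have rvW: "random_variable N' (W t)" if "t \<in> T" for t
    using W that N unfolding indep_vars_def by auto
  show ?thesis
  proof (rule indep_vars_finite_sets)
    show "finite (T \<times> I)" using fin by simp
    show "random_variable (case j of (t, k) \<Rightarrow> L k) (case j of (t, k) \<Rightarrow> \<lambda>\<omega>. F k (W t \<omega>))"
      if "j \<in> T \<times> I" for j
      using that measurable_compose[OF rvW F] by auto
  next
    fix A assume A: "\<And>j. j \<in> T \<times> I \<Longrightarrow> A j \<in> sets (case j of (t, k) \<Rightarrow> L k)"
    \<comment> \<open>All constraints on the components at time \<open>t\<close>, packed into one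
      event of the vector \<open>W t\<close>.\<close>
    define C where "C t = (\<Inter>k\<in>I. F k -` A (t, k) \<inter> space N')" for t
    have C: "C t \<in> sets (N t)" if "t \<in> T" for t
      unfolding C_def N[OF that] using False fin A that
      by (intro sets.finite_INT measurable_sets[OF F]) auto
    have WC: "W t -` C t \<inter> space M = (\<Inter>k\<in>I. (\<lambda>\<omega>. F k (W t \<omega>)) -` A (t, k) \<inter> space M)"
      if "t \<in> T" for t
      using False measurable_space[OF rvW[OF that]] by (auto simp: C_def)
    have "(\<Inter>j\<in>T \<times> I. (case j of (t, k) \<Rightarrow> \<lambda>\<omega>. F k (W t \<omega>)) -` A j \<inter> space M)
        = (\<Inter>t\<in>T. W t -` C t \<inter> space M)"
      using WC by auto
    then have "prob (\<Inter>j\<in>T \<times> I. (case j of (t, k) \<Rightarrow> \<lambda>\<omega>. F k (W t \<omega>)) -` A j \<inter> space M)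
        = (\<Prod>t\<in>T. prob (W t -` C t \<inter> space M))"
      using indep_varsD_finite[OF W] False fin C by simp
    also have "\<dots> = (\<Prod>t\<in>T. \<Prod>k\<in>I. prob ((\<lambda>\<omega>. F k (W t \<omega>)) -` A (t, k) \<inter> space M))"
      using False fin A by (intro prod.cong refl) (subst WC, simp, intro indep_varsD_finite[OF comp], auto)
    also have "\<dots> = (\<Prod>j\<in>T \<times> I. prob ((case j of (t, k) \<Rightarrow> \<lambda>\<omega>. F k (W t \<omega>)) -` A j \<inter> space M))"
      by (simp add: prod.cartesian_product case_prod_unfold)
    finally show "prob (\<Inter>j\<in>T \<times> I. (case j of (t, k) \<Rightarrow> \<lambda>\<omega>. F k (W t \<omega>)) -` A j \<inter> space M)
        = (\<Prod>j\<in>T \<times> I. prob ((case j of (t, k) \<Rightarrow> \<lambda>\<omega>. F k (W t \<omega>)) -` A j \<inter> space M))" .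
  qed
qed

subsection \<open>Complex Gaussian vectors in an orthonormal basis\<close>

text \<open>Bridges linearity for \<open>*s\<close> over the complex numbers and the real linearity
  used for continuity and Lebesgue measure.\<close>

lemma linear_of_complex_linear:
  fixes f :: "complex^'n \<Rightarrow> complex^'m"
  assumes "Vector_Spaces.linear (*s) (*s) f"
  shows "linear f"
proof (rule linearI)
  fix c :: real and x y :: "complex^'n"
  have scaleR: "c *\<^sub>R z = complex_of_real c *s z" for z :: "complex^'k"
    by (auto simp: vec_eq_iff complex_eq_iff)
  show "f (x + y) = f x + f y" by (rule vec.linear_add[OF assms])
  show "f (c *\<^sub>R x) = c *\<^sub>R f x" unfolding scaleR by (rule vec.linear_scale[OF assms])
qed

lemma borel_measurable_complex_linear:
  fixes f :: "complex^'n \<Rightarrow> complex^'m"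
  assumes "Vector_Spaces.linear (*s) (*s) f"
  shows "f \<in> borel_measurable borel"
  using linear_of_complex_linear[OF assms]
  by (intro borel_measurable_continuous_onI linear_continuous_on)
    (simp add: linear_conv_bounded_linear)

lemma borel_measurable_cinner [measurable]: "(\<lambda>z. cinner z s) \<in> borel_measurable borel"
  unfolding cinner_def by (intro borel_measurable_continuous_onI continuous_intros)

text \<open>The basis is indexed by \<open>'n\<close> itself, so that the change of coordinates is a
  self-map and can be tested for preserving \<open>lborel\<close>.\<close>

definition coords :: "('n \<Rightarrow> complex^'n) \<Rightarrow> complex^'n \<Rightarrow> complex^'n" where
  "coords c z = (\<chi> i. cinner z (c i))"

lemma linear_coords: "Vector_Spaces.linear (*s) (*s) (coords c)"
  by unfold_locales (simp_all add: coords_def vec_eq_iff cinner_add_left cinner_scale_left)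

lemma full_orthonormal_span:
  fixes S :: "(complex^'n) set"
  assumes "orthonormal_set S" "card S = CARD('n)"
  shows "vec.span S = UNIV"
  using vec.subspace_dim_equal[of "vec.span S" UNIV] card_orthonormal[OF assms(1)] assms(2)
  by (simp add: vec.dim_UNIV card_cart_basis vec.subspace_span)

text \<open>Parseval: \<open>CARD('n)\<close> orthonormal vectors span the space, so
  \<open>z\<close> is its own Fourier sum.\<close>

lemma norm_coords:
  fixes c :: "'n \<Rightarrow> complex^'n"
  assumes "orthonormal_set (range c)" "inj c"
  shows "norm (coords c z) = norm z"
proof -
  have "vec.span (range c) = UNIV"
    using assms by (intro full_orthonormal_span) (simp_all add: card_image)
  then have "fourier_sum (range c) z = z"
    using orth_proj_fourier[OF assms(1), of z] by (simp add: orth_proj_id)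
  then have "cinner z z = cinner (fourier_sum (range c) z) z" by simp
  also have "\<dots> = (\<Sum>i\<in>UNIV. cinner z (c i) * cinner (c i) z)"
    using assms(2) by (simp add: fourier_sum_def cinner_sum_left cinner_scale_left sum.reindex)
  also have "\<dots> = (\<Sum>i\<in>UNIV. cinner z (c i) * cnj (cinner z (c i)))"
    by (simp add: cinner_commute[of "c _" z])
  also have "\<dots> = cinner (coords c z) (coords c z)"
    unfolding cinner_def[of "coords c z"] by (simp add: coords_def)
  finally have "(norm z)\<^sup>2 = (norm (coords c z))\<^sup>2"
    unfolding cinner_self of_real_eq_iff .
  then show ?thesis by simp
qed

text \<open>The exponential turns the sum of squared coordinate norms into a product. Together with
  \<open>norm_coords\<close> the density becomes a product in every orthonormal basis.\<close>

lemma std_complex_normal_density_vec: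
  "ennreal (std_complex_normal_density CARD('n) (z :: complex^'n))
    = (\<Prod>i\<in>UNIV. ennreal (std_complex_normal_density 1 (z $ i)))"
proof -
  have "(norm z)\<^sup>2 = (\<Sum>i\<in>UNIV. (norm (z $ i))\<^sup>2)"
    by (simp add: norm_vec_def L2_set_def sum_nonneg)
  then have "std_complex_normal_density CARD('n) z
      = (\<Prod>i\<in>UNIV. std_complex_normal_density 1 (z $ i))"
    by (simp add: std_complex_normal_density_def prod_dividef exp_sum flip: sum_negf)
  then show ?thesis
    by (simp add: prod_ennreal std_complex_normal_density_def)
qed

lemma borel_measurable_std_complex_normal_density [measurable]:
  "(std_complex_normal_density d :: 'a::euclidean_space \<Rightarrow> real) \<in> borel_measurable borel"
  unfolding std_complex_normal_density_def[abs_def] by measurable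

context prob_space
begin

text \<open>The density depends on the norm only, so \<open>coords c\<close> preserves it along with
  Lebesgue measure, and the joint probability of coordinate events becomes a product of
  one-dimensional integrals.\<close>

lemma std_complex_normal_full_coords:
  fixes X :: "'a \<Rightarrow> complex^'n"
    and c :: "'n \<Rightarrow> complex^'n"
  assumes X: "std_complex_normal M X" and c: "orthonormal_set (range c)" "inj c"
  shows "indep_vars (\<lambda>_. borel) (\<lambda>i \<omega>. cinner (X \<omega>) (c i)) UNIV"
    and "distributed M lborel (\<lambda>\<omega>. cinner (X \<omega>) (c i))
      (\<lambda>z. ennreal (std_complex_normal_density 1 z))"
proof -
  let ?g = "\<lambda>z::complex^'n. ennreal (std_complex_normal_density CARD('n) z)"
  let ?g1 = "\<lambda>z::complex. ennreal (std_complex_normal_density 1 z)"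
  let ?Y = "\<lambda>i \<omega>. cinner (X \<omega>) (c i)"
  have D: "distributed M lborel X ?g" using X by (simp add: std_complex_normal_def)
  then have [measurable]: "X \<in> borel_measurable M" by (simp add: distributed_def)
  have U [measurable]: "coords c \<in> borel_measurable borel"
    by (rule borel_measurable_complex_linear[OF linear_coords])
  define q where "q A = (\<integral>\<^sup>+y. ?g1 y * indicator A y \<partial>lborel)" for A
  have joint: "emeasure M (\<Inter>i\<in>UNIV. ?Y i -` A i \<inter> space M) = (\<Prod>i\<in>UNIV. q (A i))"
    if A [measurable]: "\<And>i. A i \<in> sets borel" for A
  proof -
    let ?h = "\<lambda>y::complex^'n. \<Prod>i\<in>UNIV. ?g1 (y $ i) * indicator (A i) (y $ i)"
    have [measurable]: "?h \<in> borel_measurable borel" by measurable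
    have "emeasure M (\<Inter>i\<in>UNIV. ?Y i -` A i \<inter> space M)
        = (\<integral>\<^sup>+\<omega>. indicator (\<Inter>i\<in>UNIV. ?Y i -` A i \<inter> space M) \<omega> \<partial>M)"
      by (rule nn_integral_indicator[symmetric]) measurable
    also have "\<dots> = (\<integral>\<^sup>+\<omega>. (\<Prod>i\<in>UNIV. indicator (A i) (coords c (X \<omega>) $ i)) \<partial>M)"
      by (intro nn_integral_cong) (auto simp: coords_def indicator_def prod_zero_iff)
    also have "\<dots> = (\<integral>\<^sup>+z. ?g z * (\<Prod>i\<in>UNIV. indicator (A i) (coords c z $ i)) \<partial>lborel)"
      by (rule distributed_nn_integral[OF D, symmetric]) measurable
    also have "\<dots> = (\<integral>\<^sup>+z. ?h (coords c z) \<partial>lborel)"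
    proof (rule nn_integral_cong)
      fix z
      have "?g z = ?g (coords c z)"
        by (simp add: std_complex_normal_density_def norm_coords[OF c])
      then show "?g z * (\<Prod>i\<in>UNIV. indicator (A i) (coords c z $ i)) = ?h (coords c z)"
        by (simp add: std_complex_normal_density_vec prod.distrib)
    qed
    also have "\<dots> = (\<integral>\<^sup>+y. ?h y \<partial>distr lborel borel (coords c))"
      by (subst nn_integral_distr) auto
    also have "distr lborel borel (coords c) = lborel"
      by (rule lborel_distr_linear_isometry)
        (simp_all add: linear_of_complex_linear[OF linear_coords] norm_coords[OF c])
    also have "(\<integral>\<^sup>+y. ?h y \<partial>lborel) = (\<Prod>i\<in>UNIV. q (A i))"
      unfolding q_def by (rule nn_integral_lborel_vec_prod) measurable
    finally show ?thesis .
  qed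
  \<comment> \<open>The normalization comes without evaluating a Gaussian integral: \<open>X\<close>
    has total probability 1, and a nonnegative number with a positive power equal to 1 is 1.\<close>
  have "q UNIV ^ CARD('n) = 1"
    using joint[of "\<lambda>_. UNIV"] by (simp add: emeasure_space_1)
  then have q1: "q UNIV = 1"
    using power_eq_imp_eq_base[of _ "CARD('n)" "1::real"]
    by (cases "q UNIV") (auto simp: ennreal_power top_power_ennreal)
  \<comment> \<open>The joint formula with all other coordinates unconstrained, each contributing
    \<open>q UNIV = 1\<close>.\<close>
  have marginal: "emeasure M (?Y i -` B \<inter> space M) = q B" if [measurable]: "B \<in> sets borel" for B i
  proof -
    have "?Y i -` B \<inter> space M = (\<Inter>j\<in>UNIV. ?Y j -` (if j = i then B else UNIV) \<inter> space M)"
      by (auto split: if_splits)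
    then have "emeasure M (?Y i -` B \<inter> space M) = (\<Prod>j\<in>UNIV. q (if j = i then B else UNIV))"
      using joint[of "\<lambda>j. if j = i then B else UNIV"] by simp
    also have "\<dots> = (\<Prod>j\<in>UNIV. if j = i then q B else 1)"
      by (intro prod.cong) (auto simp: q1)
    finally show ?thesis by simp
  qed
  show "distributed M lborel (?Y i) ?g1" for i
    unfolding distributed_def
  proof (intro conjI measure_eqI)
    fix B assume "B \<in> sets (distr M lborel (?Y i))"
    then have [measurable]: "B \<in> sets borel" by simp
    show "emeasure (distr M lborel (?Y i)) B = emeasure (density lborel ?g1) B"
      by (simp add: emeasure_distr emeasure_density marginal q_def)
  qed simp_all
  show "indep_vars (\<lambda>_. borel) ?Y UNIV"
  proof (rule indep_vars_finite_sets)
    fix A :: "'n \<Rightarrow> complex set" assume "\<And>i. i \<in> UNIV \<Longrightarrow> A i \<in> sets borel"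
    then have A: "\<And>i. A i \<in> sets borel" by simp
    have "ennreal (prob (\<Inter>j\<in>UNIV. ?Y j -` A j \<inter> space M))
        = (\<Prod>j\<in>UNIV. ennreal (prob (?Y j -` A j \<inter> space M)))"
      using joint[OF A] marginal[OF A] by (simp add: emeasure_eq_measure)
    then show "prob (\<Inter>j\<in>UNIV. ?Y j -` A j \<inter> space M) = (\<Prod>j\<in>UNIV. prob (?Y j -` A j \<inter> space M))"
      by (simp add: prod_ennreal prod_nonneg)
  qed simp_all
qed

text \<open>Extend \<open>S\<close> to a full orthonormal basis, enumerate that basis by
  \<open>'n\<close>, and restrict the independent coordinates back to \<open>S\<close>.\<close>

lemma std_complex_normal_orthonormal:
  fixes X :: "'a \<Rightarrow> complex^'n"
  assumes X: "std_complex_normal M X" and S: "orthonormal_set S"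
  shows "indep_vars (\<lambda>_. borel) (\<lambda>s \<omega>. cinner (X \<omega>) s) S"
    and "s \<in> S \<Longrightarrow> distributed M lborel (\<lambda>\<omega>. cinner (X \<omega>) s)
      (\<lambda>z. ennreal (std_complex_normal_density 1 z))"
proof -
  obtain T where T: "S \<subseteq> T" "orthonormal_set T" "vec.span T = UNIV"
    using orthonormal_extension[OF vec.subspace_UNIV S] by blast
  have "card T = CARD('n)"
    using card_orthonormal[OF T(2)] T(3) by (simp add: vec.dim_UNIV card_cart_basis)
  then obtain c :: "'n \<Rightarrow> complex^'n" where c: "bij_betw c UNIV T"
    using finite_same_card_bij[of "UNIV :: 'n set" T] finite_orthonormal[OF T(2)] by auto
  then have c': "orthonormal_set (range c)" "inj c" using T(2) by (auto simp: bij_betw_def)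
  have SR: "S \<subseteq> range c" using c T(1) by (simp add: bij_betw_def)
  have h: "c (inv c s) = s" if "s \<in> S" for s using SR that by (auto intro: f_inv_into_f)
  have "inj_on (inv c) S" using SR by (rule inj_on_inv_into)
  moreover have "indep_vars (\<lambda>_. borel) (\<lambda>i \<omega>. cinner (X \<omega>) (c i)) (inv c ` S)"
    by (rule indep_vars_subset[OF std_complex_normal_full_coords(1)[OF X c']]) simp
  ultimately have "indep_vars (\<lambda>_. borel) (\<lambda>s \<omega>. cinner (X \<omega>) (c (inv c s))) S"
    using indep_vars_reindex by blast
  also have "?this \<longleftrightarrow> indep_vars (\<lambda>_. borel) (\<lambda>s \<omega>. cinner (X \<omega>) s) S"
    by (intro indep_vars_cong refl) (simp add: h)
  finally show "indep_vars (\<lambda>_. borel) (\<lambda>s \<omega>. cinner (X \<omega>) s) S" .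
  show "distributed M lborel (\<lambda>\<omega>. cinner (X \<omega>) s) (\<lambda>z. ennreal (std_complex_normal_density 1 z))"
    if "s \<in> S"
    using std_complex_normal_full_coords(2)[OF X c', of "inv c s"] h[OF that] by simp
qed

text \<open>The projection residual is orthogonal to \<open>V\<close>, so against a basis of
  \<open>V\<close> the projected vector has the same coordinates as \<open>X\<close>.\<close>

lemma std_complex_normal_on_orth_proj:
  fixes X :: "'a \<Rightarrow> complex^'n"
  assumes X: "std_complex_normal M X" and V: "vec.subspace V"
  shows "std_complex_normal_on M V (\<lambda>\<omega>. orth_proj V (X \<omega>))"
  unfolding std_complex_normal_on_def
proof (intro conjI allI impI ballI)
  have [measurable]: "X \<in> borel_measurable M"
    using X by (simp add: std_complex_normal_def distributed_def)
  from borel_measurable_complex_linear[OF linear_orth_proj[OF V]]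
  show "(\<lambda>\<omega>. orth_proj V (X \<omega>)) \<in> borel_measurable M" by measurable
  fix b assume b: "orthonormal_basis V b"
  let ?I = "{..<vec.dim V}"
  have bV: "k \<in> ?I \<Longrightarrow> b k \<in> V" for k using b by (simp add: orthonormal_basis_def)
  have eq: "cinner (orth_proj V (X \<omega>)) (b k) = cinner (X \<omega>) (b k)" if "k \<in> ?I" for k \<omega>
    using cinner_orth_proj_residual[OF V bV[OF that], of "X \<omega>"] by (simp add: cinner_diff_left)
  \<comment> \<open>The family has to become a set and be indexed back. A repeated vector would have
    inner product both 0 and 1 with itself.\<close>
  have inj: "inj_on b ?I"
  proof (rule inj_onI)
    fix j k assume jk: "j \<in> ?I" "k \<in> ?I"
    then have "cinner (b j) (b k) = (if j = k then 1 else 0)" "cinner (b j) (b j) = 1"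
      using b unfolding orthonormal_basis_def by auto
    moreover assume "b j = b k"
    ultimately show "j = k" by (auto split: if_splits)
  qed
  have S: "orthonormal_set (b ` ?I)"
    using b inj unfolding orthonormal_set_def orthonormal_basis_def by (auto simp: inj_on_def)
  have "indep_vars (\<lambda>_. borel) (\<lambda>k \<omega>. cinner (X \<omega>) (b k)) ?I"
    using indep_vars_reindex[OF std_complex_normal_orthonormal(1)[OF X S] inj] .
  also have "?this \<longleftrightarrow> indep_vars (\<lambda>_. borel) (\<lambda>k \<omega>. cinner (orth_proj V (X \<omega>)) (b k)) ?I"
    by (intro indep_vars_cong refl) (simp add: eq)
  finally show "indep_vars (\<lambda>_. borel) (\<lambda>k \<omega>. cinner (orth_proj V (X \<omega>)) (b k)) ?I" .
  show "distributed M lborel (\<lambda>\<omega>. cinner (orth_proj V (X \<omega>)) (b k))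
      (\<lambda>z. ennreal (std_complex_normal_density 1 z))" if "k < vec.dim V" for k
    using std_complex_normal_orthonormal(2)[OF X S, of "b k"] that by (simp add: eq)
qed (use V orth_proj_in[OF V] in auto)

end

subsection \<open>The subsystems on the generalized eigenspaces\<close>

lemma linear_restr: "Vector_Spaces.linear (*s) (*s) (restr A c)"
  unfolding restr_def[abs_def]
  using Vector_Spaces.linear_compose[OF linear_orth_proj[OF subspace_gen_eigenspace]
      matrix_vector_mul_linear_gen[of A]]
  by (simp add: o_def)

lemma linear_system_B_proc:
  "linear_system (restr A c) (\<lambda>t. proj_noise A w c t \<omega>) (\<lambda>t. B_proc A w c t \<omega>)"
  unfolding linear_system_def
proof (intro conjI allI)
  show "B_proc A w c 0 \<omega> = 0" by (simp add: B_proc_def)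
  fix t
  \<comment> \<open>The summand \<open>s = Suc t\<close> has exponent 0 and noise index
    \<open>t\<close>, so it is the fresh noise; from every other summand one application of
    \<open>restr A c\<close> splits off.\<close>
  have "B_proc A w c (Suc t) \<omega>
      = (\<Sum>s=1..t. (restr A c ^^ (Suc t - s)) (proj_noise A w c (s - 1) \<omega>)) + proj_noise A w c t \<omega>"
    by (simp add: B_proc_def)
  also have "(\<Sum>s=1..t. (restr A c ^^ (Suc t - s)) (proj_noise A w c (s - 1) \<omega>))
      = (\<Sum>s=1..t. restr A c ((restr A c ^^ (t - s)) (proj_noise A w c (s - 1) \<omega>)))"
    by (intro sum.cong) (simp_all add: Suc_diff_le)
  also have "\<dots> = restr A c (B_proc A w c t \<omega>)"
    unfolding B_proc_def by (rule vec.linear_sum[OF linear_restr, symmetric])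
  finally show "B_proc A w c (Suc t) \<omega> = restr A c (B_proc A w c t \<omega>) + proj_noise A w c t \<omega>" .
qed

text \<open>Both the noise and the argument of \<open>A\<close> are projected into the subspace, and
  \<open>A\<close> keeps it invariant. Hence \<open>restr A c\<close> acts on these states as
  \<open>A\<close> itself.\<close>

lemma B_proc_in_gen_eigenspace: "B_proc A w c t \<omega> \<in> gen_eigenspace A c"
proof (induction t)
  case 0
  then show ?case
    using linear_system_B_proc[of A c w \<omega>] vec.subspace_0[OF subspace_gen_eigenspace]
    by (simp add: linear_system_def)
next
  case (Suc t)
  have "restr A c v + proj_noise A w c t \<omega> \<in> gen_eigenspace A c" for v
    unfolding restr_def proj_noise_def
    by (intro vec.subspace_add subspace_gen_eigenspace gen_eigenspace_invariant orth_proj_in)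
  then show ?case using linear_system_B_proc[of A c w \<omega>] by (simp add: linear_system_def)
qed

text \<open>On the states of each subsystem \<open>restr\<close> agrees with \<open>A\<close>, and
  the projected noises add up to \<open>w\<close>, so the sum satisfies the recursion of
  \<open>y\<close> with the same initial value.\<close>

lemma linear_system_sum_B_proc:
  assumes sys: "linear_system (\<lambda>v. A *v v) (\<lambda>t. w t \<omega>) y"
    and res: "\<And>v. (\<Sum>m\<in>I. spectral_proj A (lam m) v) = v"
  shows "y i = (\<Sum>m\<in>I. B_proc A w (lam m) i \<omega>)"
proof (induction i)
  case 0
  then show ?case using sys by (simp add: linear_system_def B_proc_def)
next
  case (Suc i)
  have B: "B_proc A w (lam m) (Suc i) \<omega>
      = A *v B_proc A w (lam m) i \<omega> + spectral_proj A (lam m) (w i \<omega>)" for m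
    using linear_system_B_proc[of A "lam m" w \<omega>]
    by (simp add: linear_system_def restr_def proj_noise_def
        orth_proj_id[OF subspace_gen_eigenspace B_proc_in_gen_eigenspace])
  have "y (Suc i) = A *v y i + w i \<omega>" using sys by (simp add: linear_system_def)
  also have "\<dots> = (\<Sum>m\<in>I. A *v B_proc A w (lam m) i \<omega>) + (\<Sum>m\<in>I. spectral_proj A (lam m) (w i \<omega>))"
    by (simp add: Suc res vec.linear_sum[OF matrix_vector_mul_linear_gen])
  also have "\<dots> = (\<Sum>m\<in>I. B_proc A w (lam m) (Suc i) \<omega>)"
    by (simp add: B sum.distrib)
  finally show ?case .
qed

context prob_space
begin

lemma indep_vars_data_matrix_B_proc:
  fixes A :: "complex^'n^'n" and w :: "nat \<Rightarrow> 'a \<Rightarrow> complex^'n"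
  assumes w: "indep_vars (\<lambda>_. borel) w UNIV" "\<And>t. std_complex_normal M (w t)"
    and T: "\<And>m. m \<in> I \<Longrightarrow> orthonormal_set (T m)"
      "\<And>m. m \<in> I \<Longrightarrow> vec.span (T m) = gen_eigenspace A (lam m)"
      "disjoint_family_on T I" "orthonormal_set (\<Union>m\<in>I. T m)"
  shows "indep_vars (\<lambda>_. \<Pi>\<^sub>M t\<in>{..<N}. borel) (\<lambda>m. data_matrix N (B_proc A w (lam m))) I"
proof -
  let ?S = "\<Union>m\<in>I. T m"
  have "indep_vars (\<lambda>(t, s). borel) (\<lambda>(t, s) \<omega>. cinner (w t \<omega>) s) ({..<N} \<times> ?S)"
  proof (rule indep_vars_components[where N="\<lambda>_. borel" and N'=borel])
    show "indep_vars (\<lambda>_. borel) w {..<N}" using w(1) by (rule indep_vars_subset) simp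
    show "finite ?S" using T(4) by (rule finite_orthonormal)
    show "indep_vars (\<lambda>_. borel) (\<lambda>k \<omega>. cinner (w t \<omega>) k) ?S" for t
      by (rule std_complex_normal_orthonormal(1)[OF w(2) T(4)])
  qed (auto intro: borel_measurable_cinner)
  then have ind: "indep_vars (\<lambda>_. borel) (\<lambda>j \<omega>. cinner (w (fst j) \<omega>) (snd j)) ({..<N} \<times> ?S)"
    by (simp add: case_prod_unfold)
  \<comment> \<open>The block of noise coordinates along subspace \<open>m\<close>. Blocks are
    disjoint because the bases \<open>T m\<close> are.\<close>
  define K where "K m = {..<N} \<times> T m" for m
  have K: "indep_vars (\<lambda>m. Pi\<^sub>M (K m) (\<lambda>_. borel))
      (\<lambda>m \<omega>. restrict (\<lambda>j. cinner (w (fst j) \<omega>) (snd j)) (K m)) I"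
    using T(3) by (intro indep_vars_restrict[OF ind]) (auto simp: K_def disjoint_family_on_def)
  \<comment> \<open>The deterministic map that rebuilds trajectory \<open>m\<close> from its block:
    the inner sum is the Fourier sum of the projected noise, the outer one is the formula of
    \<open>B_proc\<close>.\<close>
  define Y where "Y m f = (\<lambda>t\<in>{..<N}. \<Sum>r=1..t. (restr A (lam m) ^^ (t - r))
      (\<Sum>s\<in>T m. f (r - 1, s) *s s))" for m and f :: "nat \<times> (complex^'n) \<Rightarrow> complex"
  have Y: "Y m \<in> Pi\<^sub>M (K m) (\<lambda>_. borel) \<rightarrow>\<^sub>M (\<Pi>\<^sub>M t\<in>{..<N}. borel)" for m
    unfolding Y_def
  proof (intro measurable_restrict borel_measurable_sum)
    fix t r assume tr: "t \<in> {..<N}" "r \<in> {1..t}"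
    have scale: "(\<lambda>z. z *s s) \<in> borel_measurable borel" for s :: "complex^'n"
      unfolding vector_scalar_mult_def by (intro borel_measurable_continuous_onI continuous_intros)
    have "(\<lambda>f. \<Sum>s\<in>T m. f (r - 1, s) *s s) \<in> borel_measurable (Pi\<^sub>M (K m) (\<lambda>_. borel))"
      using tr by (intro borel_measurable_sum measurable_compose[OF _ scale]
          measurable_component_singleton) (auto simp: K_def)
    then show "(\<lambda>f. (restr A (lam m) ^^ (t - r)) (\<Sum>s\<in>T m. f (r - 1, s) *s s))
        \<in> borel_measurable (Pi\<^sub>M (K m) (\<lambda>_. borel))"
      by (rule measurable_compose[OF _ borel_measurable_complex_linear[OF linear_funpow[OF linear_restr]]])
  qed
  have eq: "Y m (restrict (\<lambda>j. cinner (w (fst j) \<omega>) (snd j)) (K m))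
      = data_matrix N (B_proc A w (lam m)) \<omega>" if m: "m \<in> I" for m \<omega>
  proof -
    have "(\<Sum>s\<in>T m. restrict (\<lambda>j. cinner (w (fst j) \<omega>) (snd j)) (K m) (r - 1, s) *s s)
        = proj_noise A w (lam m) (r - 1) \<omega>" if "t < N" "r \<in> {1..t}" for t r
    proof -
      \<comment> \<open>Column \<open>t < N\<close> only involves noise from times before
        \<open>t\<close>, so the finite time window \<open>{..<N}\<close> suffices.\<close>
      have "r - 1 < N" using that by auto
      then show ?thesis
        using orth_proj_fourier[OF T(1)[OF m]] T(2)[OF m]
        by (simp add: proj_noise_def fourier_sum_def K_def)
    qed
    then show ?thesis
      unfolding Y_def data_matrix_def B_proc_def by (intro restrict_ext sum.cong) simp_all
  qed
  have "indep_vars (\<lambda>_. \<Pi>\<^sub>M t\<in>{..<N}. borel)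
      (\<lambda>m \<omega>. Y m (restrict (\<lambda>j. cinner (w (fst j) \<omega>) (snd j)) (K m))) I"
    using K Y by (rule indep_vars_compose2)
  also have "?this \<longleftrightarrow> ?thesis"
    by (intro indep_vars_cong refl ext) (simp add: eq)
  finally show ?thesis .
qed

text \<open>\<open>indep_var\<close> is independence over the booleans, so the pair is reached by
  reindexing along \<open>case_bool i j\<close>.\<close>

lemma indep_var_of_indep_vars:
  assumes "indep_vars (\<lambda>_. N) X I" "i \<in> I" "j \<in> I" "i \<noteq> j"
  shows "indep_var N (X i) N (X j)"
proof -
  have "inj (case_bool i j)" using assms(4) by (auto simp: inj_def split: bool.splits)
  moreover have "indep_vars (\<lambda>_. N) X (range (case_bool i j))"
    using assms by (intro indep_vars_subset[OF assms(1)]) (auto split: bool.splits)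
  ultimately have "indep_vars (\<lambda>_. N) (\<lambda>b. X (case_bool i j b)) UNIV"
    using indep_vars_reindex by blast
  also have "?this \<longleftrightarrow> indep_vars (case_bool N N) (case_bool (X i) (X j)) UNIV"
    by (intro indep_vars_cong refl) (simp_all split: bool.splits)
  finally show ?thesis unfolding indep_var_def .
qed

end

text \<open>The last three conjuncts spell out the closing claim: each \<open>B_proc\<close> is the
  state of a linear system inside its eigenspace, of smaller dimension, and the trajectories are
  jointly independent. The guard \<open>2 \<le> K\<close> is there because a single eigenspace would
  be the whole space.\<close>

theorem mainTheorem6:
  fixes A :: "complex^'n^'n"
    and K :: nat
    and lam :: "nat \<Rightarrow> complex"
    and M :: "'a measure"
    and w x :: "nat \<Rightarrow> 'a \<Rightarrow> complex^'n"
  assumes full_rank: "rank A = CARD('n)"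
    and stable: "\<And>c. eigenvalue A c \<Longrightarrow> cmod c < 1"
    and lam_distinct: "inj_on lam {1..K}"
    and lam_spectrum: "lam ` {1..K} = {c. eigenvalue A c}"
    and geo_one: "\<And>m. m \<in> {1..K} \<Longrightarrow> geo_mult A (lam m) = 1"
    and proj_resolution: "\<And>v. (\<Sum>m=1..K. spectral_proj A (lam m) v) = v"
    and prob: "prob_space M"
    and w_indep: "prob_space.indep_vars M (\<lambda>_. borel) w UNIV"
    and w_normal: "\<And>t. std_complex_normal M (w t)"
    and x_system: "\<And>\<omega>. \<omega> \<in> space M \<Longrightarrow>
      linear_system (\<lambda>v. A *v v) (\<lambda>t. w t \<omega>) (\<lambda>t. x t \<omega>)"
  shows
    "(\<forall>i\<ge>1. \<forall>\<omega>\<in>space M. x i \<omega> = (\<Sum>m=1..K. B_proc A w (lam m) i \<omega>)) \<and>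
     (\<forall>m\<in>{1..K}.
        (\<forall>t. std_complex_normal_on M (gen_eigenspace A (lam m)) (proj_noise A w (lam m) t)) \<and>
        vec.subspace (gen_eigenspace A (lam m)) \<and>
        (\<forall>v\<in>gen_eigenspace A (lam m). A *v v \<in> gen_eigenspace A (lam m)) \<and>
        int (vec.dim (gen_eigenspace A (lam m))) = defect A (lam m) + 1) \<and>
     (\<forall>m\<in>{1..K}. \<forall>m'\<in>{1..K}. m \<noteq> m' \<longrightarrow>
        (\<forall>i. prob_space.indep_var M borel (B_proc A w (lam m) i) borel (B_proc A w (lam m') i))) \<and>
     (\<forall>m\<in>{1..K}. \<forall>\<omega>\<in>space M.
        linear_system (restr A (lam m)) (\<lambda>t. proj_noise A w (lam m) t \<omega>)
          (\<lambda>t. B_proc A w (lam m) t \<omega>) \<and>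
        (\<forall>t. B_proc A w (lam m) t \<omega> \<in> gen_eigenspace A (lam m))) \<and>
     (2 \<le> K \<longrightarrow> (\<forall>m\<in>{1..K}. vec.dim (gen_eigenspace A (lam m)) < CARD('n))) \<and>
     (\<forall>N.
        (\<forall>\<omega>\<in>space M. \<forall>t<N.
           data_matrix N x \<omega> t = (\<Sum>m=1..K. data_matrix N (B_proc A w (lam m)) \<omega> t)) \<and>
        prob_space.indep_vars M (\<lambda>_. \<Pi>\<^sub>M t\<in>{..<N}. borel)
          (\<lambda>m. data_matrix N (B_proc A w (lam m))) {1..K})"
proof (intro conjI allI ballI impI)
  interpret prob_space M by (rule prob)
  let ?V = "\<lambda>m. gen_eigenspace A (lam m)"
  obtain T where T: "\<And>m. m \<in> {1..K} \<Longrightarrow> orthonormal_set (T m)"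
      "\<And>m. m \<in> {1..K} \<Longrightarrow> vec.span (T m) = ?V m"
      "disjoint_family_on T {1..K}" "orthonormal_set (\<Union>m\<in>{1..K}. T m)"
    and dims: "(\<Sum>m=1..K. vec.dim (?V m)) = CARD('n)"
    using resolution_orthonormal_basis[of "{1..K}" ?V] subspace_gen_eigenspace proj_resolution
    by blast
  \<comment> \<open>Stability excludes the eigenvalue 1, which shows that the characteristic
    polynomial is nonzero without computing its leading coefficient.\<close>
  have "poly (charpoly A) 1 \<noteq> 0" using stable[of 1] by (auto simp: eigenvalue_iff_root)
  then have "charpoly A \<noteq> 0" by auto
  then have "(\<Sum>m=1..K. alg_mult A (lam m)) \<le> CARD('n)"
    using sum_alg_mult_le[of A "lam ` {1..K}"] lam_distinct by (simp add: sum.reindex)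
  moreover have le: "vec.dim (?V m) \<le> alg_mult A (lam m)" if "m \<in> {1..K}" for m
    using dim_gen_eigenspace_le[of A "lam m"] geo_one[OF that] by simp
  \<comment> \<open>The termwise bounds sum to \<open>CARD('n)\<close> on the left and at most
    \<open>CARD('n)\<close> on the right, so none of them is strict.\<close>
  ultimately have dim_eq: "vec.dim (?V m) = alg_mult A (lam m)" if "m \<in> {1..K}" for m
    using sum_mono_inv[of "\<lambda>m. vec.dim (?V m)" "{1..K}" "\<lambda>m. alg_mult A (lam m)" m]
      sum_mono[of "{1..K}" "\<lambda>m. vec.dim (?V m)" "\<lambda>m. alg_mult A (lam m)"] that dims le
    by auto
  have data: "indep_vars (\<lambda>_. \<Pi>\<^sub>M t\<in>{..<N}. borel) (\<lambda>m. data_matrix N (B_proc A w (lam m))) {1..K}"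
    for N
    by (rule indep_vars_data_matrix_B_proc[OF w_indep w_normal T])
  have xB: "x i \<omega> = (\<Sum>m=1..K. B_proc A w (lam m) i \<omega>)" if "\<omega> \<in> space M" for i \<omega>
    by (rule linear_system_sum_B_proc[where y="\<lambda>t. x t \<omega>", OF _ proj_resolution])
      (rule x_system[OF that])
  {
    fix i :: nat and \<omega> assume "\<omega> \<in> space M"
    then show "x i \<omega> = (\<Sum>m=1..K. B_proc A w (lam m) i \<omega>)" by (rule xB)
  next
    fix m t assume "m \<in> {1..K}"
    show "std_complex_normal_on M (?V m) (proj_noise A w (lam m) t)"
      unfolding proj_noise_def[abs_def]
      by (rule std_complex_normal_on_orth_proj[OF w_normal subspace_gen_eigenspace])
  next
    fix m show "vec.subspace (?V m)" by (rule subspace_gen_eigenspace)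
  next
    fix m v assume "v \<in> ?V m"
    then show "A *v v \<in> ?V m" by (rule gen_eigenspace_invariant)
  next
    fix m assume m: "m \<in> {1..K}"
    then show "int (vec.dim (?V m)) = defect A (lam m) + 1"
      using dim_eq geo_one by (simp add: defect_def)
  next
    fix m m' i assume mm: "m \<in> {1..K}" "m' \<in> {1..K}" "m \<noteq> m'"
    \<comment> \<open>\<open>Suc i\<close> columns are the fewest that include time
      \<open>i\<close>; evaluation at that column is measurable and preserves independence.\<close>
    have "indep_vars (\<lambda>_. borel) (\<lambda>m \<omega>. data_matrix (Suc i) (B_proc A w (lam m)) \<omega> i) {1..K}"
      by (rule indep_vars_compose2[OF data]) (simp add: measurable_component_singleton)
    then have "indep_vars (\<lambda>_. borel) (\<lambda>m. B_proc A w (lam m) i) {1..K}"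
      by (simp add: data_matrix_def)
    then show "indep_var borel (B_proc A w (lam m) i) borel (B_proc A w (lam m') i)"
      using mm by (rule indep_var_of_indep_vars)
  next
    fix m \<omega>
    show "linear_system (restr A (lam m)) (\<lambda>t. proj_noise A w (lam m) t \<omega>)
        (\<lambda>t. B_proc A w (lam m) t \<omega>)"
      by (rule linear_system_B_proc)
    show "B_proc A w (lam m) t \<omega> \<in> ?V m" for t by (rule B_proc_in_gen_eigenspace)
  next
    fix m assume K: "2 \<le> K" and m: "m \<in> {1..K}"
    obtain j where j: "j \<in> {1..K}" "j \<noteq> m"
      using K that[of 1] that[of 2] by (cases "m = 1") auto
    have "order (lam j) (charpoly A) \<noteq> 0"
      using j(1) lam_spectrum \<open>charpoly A \<noteq> 0\<close> order_root[of "charpoly A" "lam j"]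
      by (auto simp: eigenvalue_iff_root set_eq_iff)
    then have "0 < vec.dim (?V j)" using dim_eq[OF j(1)] by (simp add: alg_mult_def)
    also have "\<dots> \<le> (\<Sum>k\<in>{1..K} - {m}. vec.dim (?V k))"
      using j by (intro member_le_sum) auto
    finally show "vec.dim (?V m) < CARD('n)"
      using dims sum.remove[OF _ m, of "\<lambda>k. vec.dim (?V k)"] by simp
  next
    fix N t :: nat and \<omega> assume "\<omega> \<in> space M" "t < N"
    then show "data_matrix N x \<omega> t = (\<Sum>m=1..K. data_matrix N (B_proc A w (lam m)) \<omega> t)"
      by (simp add: data_matrix_def xB)
  next
    fix N
    show "indep_vars (\<lambda>_. \<Pi>\<^sub>M t\<in>{..<N}. borel) (\<lambda>m. data_matrix N (B_proc A w (lam m))) {1..K}"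
      by (rule data)
  }
qed

end
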